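(* Let $R:\mathbb{R}\to\mathbb{R}$ be real analytic with $R(0)=0$ and Taylor expansion at $0$ of the form $$R(r)=d_k r^k+d_{k+1}r^{k+1}+\cdots,$$ where $d_k\neq 0$ and $k>1$. Consider the differential equation $$\dot{x}=R(r)+x^2,\qquad x\in\mathbb{R},\ r\in\mathbb{R},$$ of a non-transversal saddle-node (at $(r,x)=(0,0)$, with $r$ the bifurcation parameter). Then the scaling law is given by $$t\sim \frac{1}{r^{k/2}}\qquad\text{as } r\to 0^+ .$$
   Context: Non-transversal: writing the equation as $\dot x=f(r,x)$, the necessary conditions $f(0,0)=0=f_x(0,0)$ for a saddle-node at $(0,0)$ hold, but the transversality condition $f_r(0,0)\neq 0$ fails, i.e. $f_r(0,0)=0$. Scaling law: the asymptotic behaviour, as $r\to 0^+$, of the time $t$ that a trajectory of $\dot{x}=f(r,x)$ spends in the interval $[-1,1]$, obtained by separation of variables as $t=\int_{-1}^{1}\frac{dx}{f(r,x)}$. The symbol $\sim$ is used up to a positive multiplicative constant; for example, for $\dot x=r+x^2$ one has $t=2\arctan(1/\sqrt r)/\sqrt r$, which is written $t\sim 1/\sqrt r$ as $r\to0^+$. Topologically degenerate cases such as $\dot{x}=r^2+x^2$ are included; disregarding these cases excludes all scaling laws with even $k$.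
   Formalization: It is additionally assumed that for all small r > 0 the equation has no equilibrium in [-1,1] (equivalently d_k > 0); if d_k < 0, e.g. R(r) = -r^2, there are equilibria in [-1,1], the integral for t diverges and no scaling law as r → 0+ exists. *)

theory Defs
  imports "HOL-Analysis.Analysis" "HOL-Library.Landau_Symbols"
begin

definition real_analytic :: "(real \<Rightarrow> real) \<Rightarrow> bool" where
  "real_analytic R \<longleftrightarrow> (\<forall>a. \<exists>F. (\<lambda>h. R (a + h)) has_fps_expansion F)"

text \<open>A right-hand side \<open>f r x\<close> stands for the equation \<open>dx/ds = f(r,x)\<close> with parameter \<open>r\<close>.\<close>

definition trajectory_on :: "(real \<Rightarrow> real \<Rightarrow> real) \<Rightarrow> real \<Rightarrow> real set \<Rightarrow> (real \<Rightarrow> real) \<Rightarrow> bool" where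
  "trajectory_on f r J x \<longleftrightarrow>
     open J \<and> is_interval J \<and> (\<forall>s\<in>J. (x has_real_derivative f r (x s)) (at s))"

text \<open>Some trajectory enters \<open>[-1,1]\<close> at \<open>-1\<close>, leaves it at \<open>1\<close>, and spends exactly the time \<open>T\<close>
  in it. The equation is autonomous, so the time of entry can be taken to be 0. Since \<open>J\<close> is open and
  contains \<open>[0,T]\<close>, the trajectory is really outside \<open>[-1,1]\<close> just before 0 and just after \<open>T\<close>.\<close>

definition crosses_in_time :: "(real \<Rightarrow> real \<Rightarrow> real) \<Rightarrow> real \<Rightarrow> real \<Rightarrow> bool" where
  "crosses_in_time f r T \<longleftrightarrow> 0 < T \<and>
     (\<exists>J x. trajectory_on f r J x \<and> {0..T} \<subseteq> J \<and> {s \<in> J. x s \<in> {-1..1}} = {0..T} \<and>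
            x 0 = -1 \<and> x T = 1)"

definition passage_time :: "(real \<Rightarrow> real \<Rightarrow> real) \<Rightarrow> real \<Rightarrow> real" where
  "passage_time f r = integral {-1..1} (\<lambda>x. 1 / f r x)"

text \<open>The first conjunct makes the separation of variables meaningful: for small \<open>r > 0\<close> the integral
  exists, and it is the one and only time in which a trajectory crosses \<open>[-1,1]\<close>. In the second,
  \<open>t \<sim> g\<close> is read up to a positive multiplicative constant.\<close>

definition scaling_law :: "(real \<Rightarrow> real \<Rightarrow> real) \<Rightarrow> (real \<Rightarrow> real) \<Rightarrow> bool" where
  "scaling_law f g \<longleftrightarrow>
     (\<forall>\<^sub>F r in at_right 0. (\<lambda>x. 1 / f r x) integrable_on {-1..1} \<and>
        (\<forall>T. crosses_in_time f r T \<longleftrightarrow> T = passage_time f r)) \<and>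
     (\<exists>c>0. passage_time f \<sim>[at_right 0] (\<lambda>r. c * g r))"

end

theory Submission
  imports Defs
begin

text \<open>For small \<open>r > 0\<close> the sign of \<open>R r\<close> is that of \<open>d\<^sub>k\<close>, and the absence of equilibria forces it to be
  positive. With \<open>a = sqrt (R r)\<close>, the substitution \<open>x = a tan \<theta>\<close> turns the flow of \<open>a\<^sup>2 + x\<^sup>2\<close> into
  uniform rotation with speed \<open>a\<close>, so the passage time is \<open>2 arctan (1/a) / a\<close>, which is asymptotic
  to \<open>\<pi> / a\<close>, that is, to \<open>\<pi> / (sqrt d\<^sub>k r\<^bsup>k/2\<^esup>)\<close>.\<close>

text \<open>The quotient by \<open>x ^ k\<close>, filled in at 0 with the k-th coefficient, is again
  represented by a power series, namely the shift of \<open>F\<close>, and is therefore continuous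
  at 0.\<close>

lemma has_fps_expansion_tendsto_coeff:
  fixes f :: "'a :: {banach, real_normed_field} \<Rightarrow> 'a"
  assumes f: "f has_fps_expansion F" and zero: "\<And>n. n < k \<Longrightarrow> fps_nth F n = 0"
  shows "((\<lambda>x. f x / x ^ k) \<longlongrightarrow> fps_nth F k) (at 0)"
\<comment> \<open>The zero series is split off because its \<open>subdegree\<close> is 0 by
  convention, so the bound \<open>k \<le> subdegree F\<close> would fail there for positive
  \<open>k\<close>.\<close>
proof (cases "F = 0")
  case True
  then have "\<forall>\<^sub>F x in nhds 0. f x = 0"
    using f by (simp add: has_fps_expansion_def)
  then have "\<forall>\<^sub>F x in at 0. f x / x ^ k = fps_nth F k"
    using True by (auto simp: eventually_at_filter elim: eventually_mono)
  then show ?thesis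
    by (rule tendsto_eventually)
next
  case False
  let ?g = "\<lambda>x. if x = 0 then fps_nth F k else f x / x ^ k"
  have "k \<le> subdegree F"
    using False zero by (simp add: subdegree_geI)
  then have "?g has_fps_expansion fps_shift k F"
    using f by (intro has_fps_expansion_shift) auto
  then have "continuous (at 0) ?g"
    by (rule has_fps_expansion_imp_continuous)
  then have "(?g \<longlongrightarrow> fps_nth F k) (at 0)"
    by (simp add: isCont_def)
  then show ?thesis
    by (rule Lim_transform_eventually) (auto simp: eventually_at_filter)
qed

text \<open>Stated along a curve so as to serve twice: with \<open>x\<close> the identity it yields
  an antiderivative of \<open>1 / (a\<^sup>2 + x\<^sup>2)\<close>, and along a trajectory the
  derivative becomes 1.\<close>

lemma has_real_derivative_arctan_div:
  fixes a :: real
  assumes "a > 0" and "(x has_real_derivative D) (at s within S)"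
  shows "((\<lambda>s. arctan (x s / a) / a) has_real_derivative D / (a\<^sup>2 + (x s)\<^sup>2)) (at s within S)"
proof -
  have "((\<lambda>s. arctan (x s / a) / a) has_real_derivative
      inverse (1 + (x s / a)\<^sup>2) * (D / a) / a) (at s within S)"
    by (intro DERIV_cdivide DERIV_chain2[where f = arctan] DERIV_arctan assms(2))
  also have "1 + (x s / a)\<^sup>2 = (a\<^sup>2 + (x s)\<^sup>2) / a\<^sup>2"
    using assms(1) by (simp add: field_simps)
  also have "inverse \<dots> * (D / a) / a = D / (a\<^sup>2 + (x s)\<^sup>2)"
    using assms(1) by (simp add: power2_eq_square)
  finally show ?thesis .
qed

lemma has_integral_inverse_saddle_node:
  fixes a :: real
  assumes "a > 0"
  shows "((\<lambda>x. 1 / (a\<^sup>2 + x\<^sup>2)) has_integral 2 * arctan (1 / a) / a) {-1..1}"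
proof -
  have "((\<lambda>x. 1 / (a\<^sup>2 + x\<^sup>2)) has_integral arctan (1 / a) / a - arctan (-1 / a) / a) {-1..1}"
    by (intro fundamental_theorem_of_calculus)
       (auto intro!: has_real_derivative_arctan_div[OF assms] DERIV_ident
             simp flip: has_real_derivative_iff_has_vector_derivative)
  then show ?thesis
    by (simp add: arctan_minus)
qed

text \<open>Along any trajectory \<open>arctan (x s / a) / a\<close> is a clock running at unit
  speed, so its difference from \<open>s\<close> is constant. The values -1 at entry and 1 at exit
  then determine \<open>T\<close>.\<close>

lemma crosses_in_time_saddle_node_unique:
  assumes a: "a > 0" and f: "f r = (\<lambda>x. a\<^sup>2 + x\<^sup>2)" and cr: "crosses_in_time f r T"
  shows "T = 2 * arctan (1 / a) / a"
proof -
  from cr obtain J x where T: "0 < T" and sub: "{0..T} \<subseteq> J" and x0: "x 0 = -1" and xT: "x T = 1"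
    and der: "\<And>s. s \<in> J \<Longrightarrow> (x has_real_derivative a\<^sup>2 + (x s)\<^sup>2) (at s)"
    unfolding crosses_in_time_def trajectory_on_def f by blast
  let ?h = "\<lambda>s. arctan (x s / a) / a - s"
  have h: "(?h has_real_derivative 0) (at s)" if "s \<in> {0..T}" for s
  proof -
    have "s \<in> J"
      using that sub by blast
    from DERIV_diff[OF has_real_derivative_arctan_div[OF a der[OF this]] DERIV_ident]
    show ?thesis
      using a by simp
  qed
  have "?h T = ?h 0"
  proof (rule DERIV_isconst_end[OF T])
    show "continuous_on {0..T} ?h"
      using h by (intro continuous_at_imp_continuous_on ballI DERIV_isCont) auto
  qed (use h in auto)
  then show ?thesis
    by (simp add: x0 xT arctan_minus)
qed

lemma crosses_in_time_saddle_node: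
  assumes a: "a > 0" and f: "f r = (\<lambda>x. a\<^sup>2 + x\<^sup>2)"
  shows "crosses_in_time f r (2 * arctan (1 / a) / a)"
proof -
  define \<phi> where "\<phi> = arctan (1 / a)"
  define T where "T = 2 * \<phi> / a"
  \<comment> \<open>The phase shift \<open>\<phi>\<close> makes the solution start at -1 at time 0.
    The symmetric angle \<open>\<phi>\<close>, where \<open>x\<close> is 1, is reached at time
    \<open>T\<close>.\<close>
  define \<theta> where "\<theta> s = a * s - \<phi>" for s
  define x where "x s = a * tan (\<theta> s)" for s
  \<comment> \<open>The endpoints are the blow-up times, where \<open>\<theta>\<close> equals -pi/2
    and pi/2.\<close>
  define J where "J = {(\<phi> - pi / 2) / a <..< (\<phi> + pi / 2) / a}"
  have \<phi>: "0 < \<phi>" "\<phi> < pi / 2" and tan\<phi>: "tan \<phi> = 1 / a"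
    using a arctan_ubound by (auto simp: \<phi>_def tan_arctan)
  have J_iff: "s \<in> J \<longleftrightarrow> -(pi / 2) < \<theta> s \<and> \<theta> s < pi / 2" for s
    using a by (auto simp: J_def \<theta>_def field_simps)
  have T_iff: "s \<in> {0..T} \<longleftrightarrow> -\<phi> \<le> \<theta> s \<and> \<theta> s \<le> \<phi>" for s
    using a by (auto simp: T_def \<theta>_def field_simps zero_le_mult_iff)
  have sub: "{0..T} \<subseteq> J"
    using \<phi> by (auto simp only: subset_iff J_iff T_iff)
  have "(x has_real_derivative a\<^sup>2 + (x s)\<^sup>2) (at s)" if "s \<in> J" for s
  proof -
    have c: "cos (\<theta> s) \<noteq> 0"
      using that cos_gt_zero_pi[of "\<theta> s"] by (auto simp: J_iff)
    have "(x has_real_derivative a * (inverse ((cos (\<theta> s))\<^sup>2) * a)) (at s)"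
      unfolding x_def
      by (intro DERIV_cmult DERIV_chain2[where f = tan] DERIV_tan c)
         (auto simp: \<theta>_def intro!: derivative_eq_intros)
    also have "inverse ((cos (\<theta> s))\<^sup>2) = 1 + (tan (\<theta> s))\<^sup>2"
      using tan_sec[OF c] by (simp add: power_inverse)
    also have "a * (\<dots> * a) = a\<^sup>2 + (x s)\<^sup>2"
      by (simp add: x_def power2_eq_square algebra_simps)
    finally show ?thesis .
  qed
  then have traj: "trajectory_on f r J x"
    by (simp add: trajectory_on_def f J_def is_interval_oo)
  have "x s \<in> {-1..1} \<longleftrightarrow> s \<in> {0..T}" if "s \<in> J" for s
  proof -
    \<comment> \<open>Since \<open>tan\<close> is strictly increasing between -pi/2 and pi/2, the
      bounds on \<open>x\<close> become bounds on the angle. This also shows that the solution is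
      outside \<open>[-1,1]\<close> at all times of \<open>J\<close> outside
      \<open>[0,T]\<close>.\<close>
    have "x s \<in> {-1..1} \<longleftrightarrow> tan (-\<phi>) \<le> tan (\<theta> s) \<and> tan (\<theta> s) \<le> tan \<phi>"
      using a by (auto simp: x_def tan\<phi> field_simps)
    also have "\<dots> \<longleftrightarrow> -\<phi> \<le> \<theta> s \<and> \<theta> s \<le> \<phi>"
      using that \<phi> by (intro conj_cong tan_mono_le_eq) (auto simp: J_iff)
    finally show ?thesis
      by (simp only: T_iff)
  qed
  then have "{s \<in> J. x s \<in> {-1..1}} = {0..T}"
    using sub by blast
  moreover have "x 0 = -1" "x T = 1" "0 < T"
    using a \<phi> by (auto simp: x_def \<theta>_def T_def tan\<phi>)
  ultimately have "crosses_in_time f r T"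
    unfolding crosses_in_time_def using traj sub by blast
  then show ?thesis
    by (simp add: T_def \<phi>_def)
qed

text \<open>If \<open>d\<^sub>k\<close> were negative, \<open>sqrt (- R r)\<close> and its negative
  would be equilibria in \<open>[-1,1]\<close> for all small \<open>r > 0\<close>, and no trajectory
  could cross. The assumption \<open>no_equilibria\<close> expresses that a passage is
  possible.\<close>

theorem proposition2p2:
  fixes R :: "real \<Rightarrow> real" and d :: "real fps" and k :: nat
  assumes "real_analytic R"
    and "R 0 = 0"
    and "R has_fps_expansion d"
    and "\<And>n. n < k \<Longrightarrow> fps_nth d n = 0"
    and "fps_nth d k \<noteq> 0"
    and "k > 1"
    and no_equilibria: "\<forall>\<^sub>F r in at_right 0. \<forall>x\<in>{-1..1}. R r + x\<^sup>2 \<noteq> 0"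
  shows "scaling_law (\<lambda>r x. R r + x\<^sup>2) (\<lambda>r. 1 / r powr (real k / 2))"
proof -
  let ?f = "\<lambda>r x. R r + x\<^sup>2"
  let ?D = "fps_nth d k"
  have quot: "((\<lambda>r. R r / r ^ k) \<longlongrightarrow> ?D) (at_right 0)"
    using has_fps_expansion_tendsto_coeff[OF assms(3,4)] by (rule tendsto_within_subset) auto
  have R0: "(R \<longlongrightarrow> 0) (at_right 0)"
    using has_fps_expansion_imp_continuous[OF assms(3), of "{0<..}"] assms(2)
    by (simp add: continuous_within)
  have small: "\<forall>\<^sub>F r in at_right 0. \<bar>R r\<bar> < 1"
    using order_tendstoD(2)[OF tendsto_rabs[OF R0], of 1] by simp
  \<comment> \<open>If \<open>R r \<le> 0\<close>, then \<open>sqrt (- R r)\<close> is an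
    equilibrium, and \<open>small\<close> places it in \<open>[-1,1]\<close>.\<close>
  have Rpos: "\<forall>\<^sub>F r in at_right 0. R r > 0"
    using no_equilibria small
  proof eventually_elim
    case (elim r)
    show "R r > 0"
    proof (rule ccontr)
      assume "\<not> R r > 0"
      then have "sqrt (- R r) \<in> {-1..1}" "R r + (sqrt (- R r))\<^sup>2 = 0"
        using elim(2) by (auto simp: real_le_lsqrt intro: order_trans[of _ 0])
      then show False
        using elim(1) by blast
    qed
  qed
  have rpos: "\<forall>\<^sub>F r in at_right (0::real). r > 0"
    by (simp add: eventually_at_right_less)
  \<comment> \<open>The leading coefficient is a limit of the positive quotients
    \<open>R r / r ^ k\<close>.\<close>
  have "?D \<ge> 0"
    using quot Rpos rpos
    by (intro tendsto_lowerbound[OF quot]) (auto elim: eventually_elim2)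
  with assms(5) have D: "?D > 0"
    by simp

  have eq: "?f r = (\<lambda>x. (sqrt (R r))\<^sup>2 + x\<^sup>2)" if "R r > 0" for r
    using that by simp
  have int: "((\<lambda>x. 1 / ?f r x) has_integral 2 * arctan (1 / sqrt (R r)) / sqrt (R r)) {-1..1}"
    if "R r > 0" for r
    using has_integral_inverse_saddle_node[of "sqrt (R r)"] that by simp
  then have pt: "passage_time ?f r = 2 * arctan (1 / sqrt (R r)) / sqrt (R r)" if "R r > 0" for r
    using that unfolding passage_time_def by (intro integral_unique)

  have "\<forall>\<^sub>F r in at_right 0. (\<lambda>x. 1 / ?f r x) integrable_on {-1..1} \<and>
        (\<forall>T. crosses_in_time ?f r T \<longleftrightarrow> T = passage_time ?f r)"
    using Rpos
  proof eventually_elim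
    case (elim r)
    then have "sqrt (R r) > 0"
      by simp
    then show ?case
      unfolding pt[OF elim] using int[OF elim] eq[OF elim]
        crosses_in_time_saddle_node_unique[of "sqrt (R r)" ?f r]
        crosses_in_time_saddle_node[of "sqrt (R r)" ?f r]
      by blast
  qed

  moreover have "passage_time ?f \<sim>[at_right 0] (\<lambda>r. pi / sqrt ?D * (1 / r powr (real k / 2)))"
  proof (rule asymp_equivI')
    have "filterlim (\<lambda>r. sqrt (R r)) (at_right 0) (at_right 0)"
      using tendsto_real_sqrt[OF R0] Rpos by (auto simp: filterlim_at elim: eventually_mono)
    then have "filterlim (\<lambda>r. inverse (sqrt (R r))) at_top (at_right 0)"
      by (rule filterlim_compose[OF filterlim_inverse_at_top_right])
    then have atan: "((\<lambda>r. arctan (inverse (sqrt (R r)))) \<longlongrightarrow> pi / 2) (at_right 0)"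
      by (rule filterlim_compose[OF tendsto_arctan_at_top])
    \<comment> \<open>The ratio to the claimed asymptotics is split into two factors tending to 1:
      one for the arctangent approaching pi/2, one for replacing \<open>R r\<close> by its leading
      term.\<close>
    have "((\<lambda>r. 2 * arctan (inverse (sqrt (R r))) / pi * (sqrt ?D / sqrt (R r / r ^ k)))
            \<longlongrightarrow> 2 * (pi / 2) / pi * (sqrt ?D / sqrt ?D)) (at_right 0)"
      using D by (intro tendsto_intros atan quot) auto
    then have "((\<lambda>r. 2 * arctan (inverse (sqrt (R r))) / pi * (sqrt ?D / sqrt (R r / r ^ k)))
            \<longlongrightarrow> 1) (at_right 0)"
      using D by simp
    then show "((\<lambda>r. passage_time ?f r / (pi / sqrt ?D * (1 / r powr (real k / 2)))) \<longlongrightarrow> 1) (at_right 0)"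
    proof (rule Lim_transform_eventually)
      show "\<forall>\<^sub>F r in at_right 0. 2 * arctan (inverse (sqrt (R r))) / pi * (sqrt ?D / sqrt (R r / r ^ k)) =
          passage_time ?f r / (pi / sqrt ?D * (1 / r powr (real k / 2)))"
        using Rpos rpos
      proof eventually_elim
        case (elim r)
        have "sqrt (r ^ k) = r powr (real k / 2)"
          using elim(2) by (simp add: powr_half_sqrt[symmetric] powr_powr flip: powr_realpow)
        then show ?case
          using elim D by (simp add: pt real_sqrt_divide field_simps)
      qed
    qed
  qed
  moreover have "pi / sqrt ?D > 0"
    using D by simp
  ultimately show ?thesis
    unfolding scaling_law_def by blast
qed

end
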